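(* There exists a sequence of finite simple graphs $G_k$ ($k \ge 1$), with orders $n_k \to \infty$, such that $\frac{\gamma(G_k)}{m_{G_k}[0,1)} \notin O(\log n_k)$; that is, there is no constant $C$ with $\frac{\gamma(G_k)}{m_{G_k}[0,1)} \leq C \log n_k$ for all $k$.
   Context: For a finite simple undirected graph $G$ on $n$ vertices, its Laplacian matrix is $L_G = D - A$, where $A$ is the adjacency matrix and $D$ is the diagonal matrix of vertex degrees. For a real interval $I$, $m_G(I)$ denotes the number of Laplacian eigenvalues of $G$, counted with multiplicity, lying in $I$ (note $m_G[0,1)\ge 1$ since $0$ is always an eigenvalue). A set $S$ of vertices is dominating if every vertex not in $S$ is adjacent to some vertex of $S$; the domination number $\gamma(G)$ is the minimum size of a dominating set. *)

theory Defs
  imports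
    Complex_Main
    "HOL-Library.Landau_Symbols"
    "Graph_Theory.Pair_Digraph"
    "Jordan_Normal_Form.Char_Poly"
begin

text \<open>
  Finite simple undirected graphs are the symmetric loop-free finite digraphs without multiple
  arcs, i.e. the instances of the locale \<^locale>\<open>pair_graph\<close>; an undirected edge is the pair of
  its two opposite arcs.  To write matrices with indices below the order of the graph, the vertices
  are enumerated increasingly; another enumeration would conjugate these matrices by a
  permutation matrix.
\<close>

definition vertex_at :: "'a :: linorder pair_pre_digraph \<Rightarrow> nat \<Rightarrow> 'a" where
  "vertex_at G i = sorted_list_of_set (pverts G) ! i"

definition adjacency_mat :: "'a :: linorder pair_pre_digraph \<Rightarrow> real mat" where
  "adjacency_mat G = mat (card (pverts G)) (card (pverts G))
     (\<lambda>(i, j). if (vertex_at G i, vertex_at G j) \<in> parcs G then 1 else 0)"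

definition vertex_degree :: "'a pair_pre_digraph \<Rightarrow> 'a \<Rightarrow> nat" where
  "vertex_degree G v = card {u \<in> pverts G. (v, u) \<in> parcs G}"

definition degree_mat :: "'a :: linorder pair_pre_digraph \<Rightarrow> real mat" where
  "degree_mat G = mat (card (pverts G)) (card (pverts G))
     (\<lambda>(i, j). if i = j then real (vertex_degree G (vertex_at G i)) else 0)"

definition laplacian_mat :: "'a :: linorder pair_pre_digraph \<Rightarrow> real mat" where
  "laplacian_mat G = degree_mat G - adjacency_mat G"

text \<open>
  The multiplicity of an eigenvalue is its multiplicity as a root of the characteristic polynomial;
  all eigenvalues are real because the Laplacian matrix is real symmetric.
\<close>

definition laplacian_count :: "'a :: linorder pair_pre_digraph \<Rightarrow> real set \<Rightarrow> nat" where
  "laplacian_count G I =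
     (\<Sum>x\<in>{x \<in> I. eigenvalue (laplacian_mat G) x}. Polynomial.order x (char_poly (laplacian_mat G)))"

definition dominating_set :: "'a pair_pre_digraph \<Rightarrow> 'a set \<Rightarrow> bool" where
  "dominating_set G S \<longleftrightarrow>
     S \<subseteq> pverts G \<and> (\<forall>v \<in> pverts G - S. \<exists>u \<in> S. (v, u) \<in> parcs G)"

definition domination_number :: "'a pair_pre_digraph \<Rightarrow> nat" where
  "domination_number G = Min (card ` {S. dominating_set G S})"

end

(* The witness is the m x m rook graph, of order m^2.  Its Laplacian eigenvalues are 0 (once), m and
   2m, so only the trivial eigenvalue lies in [0,1).  On the other hand fewer than m vertices miss
   some row and some column, and the vertex where these meet is then not dominated.  Hence the
   quotient is at least m, which is not O(ln (m^2)). *)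
theory Submission
  imports Defs "HOL-Real_Asymp.Real_Asymp"
begin

section \<open>Multiplicity of 0 as a root of the characteristic polynomial\<close>

lemma sum_const_poly: "(\<Sum>i\<in>S. [:f i:]) = [:\<Sum>i\<in>S. f i:]"
  by (induction S rule: infinite_finite_induct) auto

lemma char_poly_matrix_index:
  assumes "A \<in> carrier_mat n n" "i < n" "j < n"
  shows "char_poly_matrix A $$ (i, j) = (if i = j then [:0, 1:] else 0) + [:- A $$ (i, j):]"
  using assms by (auto simp: char_poly_matrix_def)

text \<open>Zero column sums put the image of \<open>A\<close> into the hyperplane of vectors with
  entry sum 0. By \<open>ker\<close> this hyperplane meets the kernel only in 0, so the kernel has
  dimension at most one and there are no longer Jordan chains. The count of eigenvalues uses root
  orders, so this algebraic multiplicity is what is wanted.\<close>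

lemma order_0_char_poly_eq_1:
  fixes A :: "'a :: field mat"
  assumes A: "A \<in> carrier_mat n n" and n: "0 < n"
    and cols: "\<And>j. j < n \<Longrightarrow> (\<Sum>i<n. A $$ (i, j)) = 0"
    and ker: "\<And>v. v \<in> carrier_vec n \<Longrightarrow> A *\<^sub>v v = 0\<^sub>v n \<Longrightarrow> (\<Sum>i<n. v $ i) = 0 \<Longrightarrow> v = 0\<^sub>v n"
  shows "Polynomial.order 0 (char_poly A) = 1"
proof -
  \<comment> \<open>Adding all rows of the characteristic matrix to the first one turns that row into a constant
    row of indeterminates. After factoring one out, the remaining determinant is nonzero at 0.\<close>
  define C where "C = char_poly_matrix A"
  define M where "M = mat n n (\<lambda>(i, j). if i = 0 then 1 else C $$ (i, j))"
  define E :: "'a poly mat" where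
    "E = mat n n (\<lambda>(i, j). if i = 0 \<or> i = j then 1 else 0)"
  have C: "C \<in> carrier_mat n n" and M: "M \<in> carrier_mat n n" and E: "E \<in> carrier_mat n n"
    using A by (auto simp: C_def M_def E_def)
  have C_cols: "(\<Sum>i<n. C $$ (i, j)) = [:0, 1:]" if j: "j < n" for j
  proof -
    have "(\<Sum>i<n. C $$ (i, j)) = (\<Sum>i<n. (if i = j then [:0, 1:] else 0)) + (\<Sum>i<n. [:- A $$ (i, j):])"
      unfolding sum.distrib[symmetric] using A j
      by (intro sum.cong) (auto simp: C_def char_poly_matrix_index)
    also have "\<dots> = [:0, 1:]"
      using cols[OF j] j by (simp add: sum_const_poly sum_negf)
    finally show ?thesis .
  qed
  have "E * C = multrow 0 [:0, 1:] M"
  proof (rule eq_matI)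
    fix i j assume "i < dim_row (multrow 0 [:0, 1:] M)" "j < dim_col (multrow 0 [:0, 1:] M)"
    then have ij: "i < n" "j < n" using M by auto
    have "(E * C) $$ (i, j) = (\<Sum>k<n. E $$ (i, k) * C $$ (k, j))"
      using ij E C by (simp add: scalar_prod_def lessThan_atLeast0)
    also have "\<dots> = (\<Sum>k<n. if i = 0 \<or> i = k then C $$ (k, j) else 0)"
      using ij by (intro sum.cong) (auto simp: E_def)
    also have "\<dots> = multrow 0 [:0, 1:] M $$ (i, j)"
      using ij M C_cols by (auto simp: M_def)
    finally show "(E * C) $$ (i, j) = multrow 0 [:0, 1:] M $$ (i, j)" .
  qed (use E C M in auto)
  then have "det E * det C = [:0, 1:] * det M"
    using det_mult[OF E C] det_multrow[OF n M] by metis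
  moreover have "det E = 1"
  proof -
    have "upper_triangular E" using E by (auto simp: E_def)
    then have "det E = prod_list (diag_mat E)" using E by (rule det_upper_triangular)
    also have "diag_mat E = map (\<lambda>_. 1) [0..<n]"
      using E by (auto simp: diag_mat_def E_def)
    finally show ?thesis by (simp add: map_replicate_const)
  qed
  ultimately have cp: "char_poly A = [:0, 1:] * det M"
    by (simp add: char_poly_def C_def)
  have M0: "poly (det M) 0 \<noteq> 0"
  proof
    assume "poly (det M) 0 = 0"
    have hom: "comm_ring_hom (\<lambda>p :: 'a poly. poly p 0)" by unfold_locales auto
    \<comment> \<open>Evaluating the indeterminate at 0 turns \<open>M\<close> into
      \<open>- A\<close> with its first row replaced by ones. A kernel vector of \<open>N\<close>
      thus has entry sum 0 and is annihilated by every row of \<open>A\<close> but the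
      first.\<close>
    define N where "N = map_mat (\<lambda>p. poly p 0) M"
    have N: "N \<in> carrier_mat n n" using M by (simp add: N_def)
    have N_index: "N $$ (i, j) = (if i = 0 then 1 else - A $$ (i, j))" if "i < n" "j < n" for i j
      using that A by (auto simp: N_def M_def C_def char_poly_matrix_index)
    have "det N = 0" using \<open>poly (det M) 0 = 0\<close> comm_ring_hom.hom_det[OF hom, of M] unfolding N_def by metis
    then obtain v where v: "v \<in> carrier_vec n" "v \<noteq> 0\<^sub>v n" "N *\<^sub>v v = 0\<^sub>v n"
      using det_0_iff_vec_prod_zero[OF N] by auto
    have Nv: "(\<Sum>j<n. N $$ (i, j) * v $ j) = 0" if "i < n" for i
    proof -
      have "(\<Sum>j<n. N $$ (i, j) * v $ j) = (N *\<^sub>v v) $ i"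
        using that N v(1) by (simp add: scalar_prod_def lessThan_atLeast0)
      then show ?thesis using v(3) that by simp
    qed
    have sum_v: "(\<Sum>j<n. v $ j) = 0"
      using Nv[OF n] n by (simp add: N_index)
    have Av: "(\<Sum>j<n. A $$ (i, j) * v $ j) = 0" if "i < n" "i \<noteq> 0" for i
      using Nv[OF that(1)] that by (simp add: N_index sum_negf)
    \<comment> \<open>The replaced row is recovered from the zero column sums: all entries of A v
      add up to 0, and all but entry 0 are known to vanish.\<close>
    have "(\<Sum>i<n. \<Sum>j<n. A $$ (i, j) * v $ j) = 0"
      by (subst sum.swap) (simp add: sum_distrib_right[symmetric] cols)
    moreover have "(\<Sum>i<n. \<Sum>j<n. A $$ (i, j) * v $ j) = (\<Sum>j<n. A $$ (0, j) * v $ j)"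
      using n Av by (subst sum.remove[of _ 0]) (auto intro!: sum.neutral)
    ultimately have "(\<Sum>j<n. A $$ (i, j) * v $ j) = 0" if "i < n" for i
      using Av that by (cases "i = 0") auto
    then have "A *\<^sub>v v = 0\<^sub>v n"
      using A v(1) by (intro eq_vecI) (auto simp: scalar_prod_def lessThan_atLeast0)
    then show False using ker v sum_v by blast
  qed
  have "det M \<noteq> 0" using M0 by auto
  then have "Polynomial.order 0 (char_poly A) =
      Polynomial.order 0 [:0, 1 :: 'a:] + Polynomial.order 0 (det M)"
    unfolding cp by (intro order_mult) simp
  moreover have "Polynomial.order 0 (det M) = 0"
    using M0 by (rule order_0I)
  moreover have "Polynomial.order 0 [:0, 1 :: 'a:] = 1"
    using order_power_n_n[of 0 1] by simp
  ultimately show ?thesis by simp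
qed

section \<open>The rook graph and its Laplacian\<close>

text \<open>The number \<open>a * m + b\<close> encodes the cell in row \<open>a\<close> and column
  \<open>b\<close>. With an initial segment of the naturals as vertex set, \<open>vertex_at\<close>
  is the identity on indices.\<close>

definition rook_graph :: "nat \<Rightarrow> nat pair_pre_digraph" where
  "rook_graph m = \<lparr>pverts = {..<m * m},
     parcs = {(u, v). u < m * m \<and> v < m * m \<and> u \<noteq> v \<and>
       (u div m = v div m \<or> u mod m = v mod m)}\<rparr>"

lemma pverts_rook_graph [simp]: "pverts (rook_graph m) = {..<m * m}"
  by (simp add: rook_graph_def)

lemma in_parcs_rook_graph [simp]:
  "(u, v) \<in> parcs (rook_graph m) \<longleftrightarrow> u < m * m \<and> v < m * m \<and> u \<noteq> v \<and>
     (u div m = v div m \<or> u mod m = v mod m)"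
  by (simp add: rook_graph_def)

lemma pair_graph_rook_graph: "pair_graph (rook_graph m)"
proof
  show "finite (parcs (rook_graph m))"
    by (rule finite_subset[of _ "{..<m * m} \<times> {..<m * m}"]) (auto simp: rook_graph_def)
  show "symmetric (with_proj (rook_graph m))"
    by (auto simp: symmetric_def arcs_ends_def arc_to_ends_def intro!: symI)
qed (auto simp: rook_graph_def)

lemma vertex_at_rook_graph: "i < m * m \<Longrightarrow> vertex_at (rook_graph m) i = i"
  by (simp add: vertex_at_def lessThan_atLeast0)

lemma sum_grid:
  fixes f :: "nat \<Rightarrow> 'a :: comm_monoid_add"
  shows "(\<Sum>i<m * m. f i) = (\<Sum>a<m. \<Sum>b<m. f (a * m + b))"
proof -
  have "(\<Sum>b<m. f (a * m + b)) = sum f {a * m..<a * m + m}" for a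
    using sum.shift_bounds_nat_ivl[of f 0 "a * m" m] by (simp add: lessThan_atLeast0 add.commute)
  then show ?thesis by (simp add: sum.nat_group)
qed

lemma grid_less: "a < m \<Longrightarrow> b < m \<Longrightarrow> a * m + b < m * (m :: nat)"
  using mult_le_mono1[of "Suc a" m m] by simp

text \<open>"Same row" and "same column" are equivalence relations, both containing the diagonal.
  The adjacency matrix is the sum of their indicator matrices minus twice the identity, so degrees
  and Laplacian reduce to this sum and its column counterpart.\<close>

lemma sum_same_row:
  fixes f :: "nat \<Rightarrow> real"
  assumes "i < m * m"
  shows "(\<Sum>j<m * m. of_bool (i div m = j div m) * f j) = (\<Sum>b<m. f (i div m * m + b))"
proof -
  have "i div m < m" using assms by (simp add: less_mult_imp_div_less)
  have "(\<Sum>j<m * m. of_bool (i div m = j div m) * f j) =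
      (\<Sum>a<m. if i div m = a then \<Sum>b<m. f (a * m + b) else 0)"
    unfolding sum_grid by (intro sum.cong) auto
  then show ?thesis using \<open>i div m < m\<close> by simp
qed

lemma sum_same_column:
  fixes f :: "nat \<Rightarrow> real"
  assumes "i < m * m"
  shows "(\<Sum>j<m * m. of_bool (i mod m = j mod m) * f j) = (\<Sum>a<m. f (a * m + i mod m))"
proof -
  have "0 < m" using assms by (cases m) auto
  have "(\<Sum>j<m * m. of_bool (i mod m = j mod m) * f j) =
      (\<Sum>a<m. \<Sum>b<m. if i mod m = b then f (a * m + b) else 0)"
    unfolding sum_grid by (intro sum.cong) auto
  then show ?thesis using \<open>0 < m\<close> by simp
qed

lemma vertex_degree_rook_graph:
  assumes "i < m * m"
  shows "real (vertex_degree (rook_graph m) i) = 2 * real m - 2"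
proof -
  have "real (vertex_degree (rook_graph m) i) = (\<Sum>j<m * m. of_bool ((i, j) \<in> parcs (rook_graph m)))"
    by (simp add: vertex_degree_def sum_of_bool_eq Int_def del: in_parcs_rook_graph)
  \<comment> \<open>Off the diagonal at most one of the two indicators is 1, since row and column
    determine the cell; on the diagonal both are, hence the correction 2. The factors 1 give the
    sums the shape of \<open>sum_same_row\<close> and \<open>sum_same_column\<close>.\<close>
  also have "\<dots> = (\<Sum>j<m * m. of_bool (i div m = j div m) * 1 + of_bool (i mod m = j mod m) * 1
      - (if j = i then 2 else 0))"
  proof (intro sum.cong refl)
    fix j assume "j \<in> {..<m * m}"
    moreover have "i = j" if "i div m = j div m" "i mod m = j mod m"
      using that by (metis div_mult_mod_eq)
    ultimately show "of_bool ((i, j) \<in> parcs (rook_graph m)) =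
      (of_bool (i div m = j div m) * 1 + of_bool (i mod m = j mod m) * 1
      - (if j = i then 2 else 0) :: real)"
      using assms by auto
  qed
  also have "\<dots> = 2 * real m - 2"
    using assms unfolding sum_subtractf sum.distrib
    by (subst sum_same_row sum_same_column, assumption)+ simp
  finally show ?thesis .
qed

lemma laplacian_rook_graph_carrier: "laplacian_mat (rook_graph m) \<in> carrier_mat (m * m) (m * m)"
  by (rule carrier_matI) (simp_all add: laplacian_mat_def degree_mat_def adjacency_mat_def)

text \<open>On the diagonal both indicators are 1, so the coefficient is the degree
  \<open>2 * m - 2\<close> plus 2.\<close>

lemma laplacian_rook_graph_index:
  assumes "i < m * m" "j < m * m"
  shows "laplacian_mat (rook_graph m) $$ (i, j) =
    (if j = i then 2 * real m else 0) - of_bool (i div m = j div m) - of_bool (i mod m = j mod m)"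
proof -
  have "i = j" if "i div m = j div m" "i mod m = j mod m"
    using that by (metis div_mult_mod_eq)
  then show ?thesis
    using assms
    by (auto simp: laplacian_mat_def degree_mat_def adjacency_mat_def vertex_at_rook_graph
        vertex_degree_rook_graph)
qed

lemma laplacian_rook_graph_mult_vec:
  assumes v: "v \<in> carrier_vec (m * m)" and ab: "a < m" "b < m"
  shows "(laplacian_mat (rook_graph m) *\<^sub>v v) $ (a * m + b) =
    2 * real m * v $ (a * m + b) - (\<Sum>b'<m. v $ (a * m + b')) - (\<Sum>a'<m. v $ (a' * m + b))"
proof -
  define i where "i = a * m + b"
  have i: "i < m * m" "i div m = a" "i mod m = b"
    using ab by (auto simp: i_def grid_less)
  have "(laplacian_mat (rook_graph m) *\<^sub>v v) $ i =
      (\<Sum>j<m * m. laplacian_mat (rook_graph m) $$ (i, j) * v $ j)"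
    using v i(1) laplacian_rook_graph_carrier[of m] by (simp add: scalar_prod_def lessThan_atLeast0)
  also have "\<dots> = (\<Sum>j<m * m. (if j = i then 2 * real m * v $ j else 0)
      - of_bool (i div m = j div m) * v $ j - of_bool (i mod m = j mod m) * v $ j)"
    using i(1) by (intro sum.cong) (auto simp: laplacian_rook_graph_index algebra_simps)
  also have "\<dots> = 2 * real m * v $ i - (\<Sum>b'<m. v $ (a * m + b')) - (\<Sum>a'<m. v $ (a' * m + b))"
    using i unfolding sum_subtractf sum_same_row[OF i(1)] sum_same_column[OF i(1)] by simp
  finally show ?thesis by (simp add: i_def)
qed

section \<open>The spectrum below m\<close>

text \<open>Summing the equation along a row or a column shows that \<open>m - x\<close> times each
  line sum is the total sum. Once the total is 0, all line sums vanish because \<open>x < m\<close>,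
  and what remains is \<open>(2 * m - x) * w a b = 0\<close>.\<close>

lemma rook_eigenfunction_eq_0:
  fixes w :: "nat \<Rightarrow> nat \<Rightarrow> real"
  assumes eq: "\<And>a b. a < m \<Longrightarrow> b < m \<Longrightarrow>
      2 * real m * w a b - (\<Sum>b'<m. w a b') - (\<Sum>a'<m. w a' b) = x * w a b"
    and x: "x < m" and nz: "x \<noteq> 0 \<or> (\<Sum>a<m. \<Sum>b<m. w a b) = 0" and ab: "a < m" "b < m"
  shows "w a b = 0"
proof -
  define R where "R a = (\<Sum>b<m. w a b)" for a
  define K where "K b = (\<Sum>a<m. w a b)" for b
  define T where "T = (\<Sum>a<m. R a)"
  have T: "T = (\<Sum>b<m. K b)" unfolding T_def R_def K_def by (rule sum.swap)
  have eq': "2 * real m * w a b - R a - K b = x * w a b" if "a < m" "b < m" for a b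
    using eq[OF that] by (simp add: R_def K_def)
  have rows: "(m - x) * R a = T" if "a < m" for a
  proof -
    have "(\<Sum>b<m. 2 * real m * w a b - R a - K b) = (\<Sum>b<m. x * w a b)"
      using that by (intro sum.cong eq') auto
    then show ?thesis
      unfolding sum_subtractf sum_distrib_left[symmetric] R_def[symmetric] T[symmetric]
      by (simp add: algebra_simps)
  qed
  have columns: "(m - x) * K b = T" if "b < m" for b
  proof -
    have "(\<Sum>a<m. 2 * real m * w a b - R a - K b) = (\<Sum>a<m. x * w a b)"
      using that by (intro sum.cong eq') auto
    then show ?thesis
      unfolding sum_subtractf sum_distrib_left[symmetric] K_def[symmetric] T_def[symmetric]
      by (simp add: algebra_simps)
  qed
  \<comment> \<open>Adding the row identities over all \<open>m\<close> rows gives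
    \<open>(m - x) * T = m * T\<close>, which forces \<open>T = 0\<close> unless
    \<open>x = 0\<close>; in that case \<open>nz\<close> supplies it.\<close>
  have "(m - x) * T = (\<Sum>a<m. (m - x) * R a)" by (simp add: T_def sum_distrib_left)
  also have "\<dots> = m * T" by (simp add: rows)
  finally have "x * T = 0" by (simp add: algebra_simps)
  then have "T = 0" using nz by (auto simp: T_def R_def)
  then have "R a = 0" "K b = 0" using rows[of a] columns[of b] ab x by auto
  then have "(2 * real m - x) * w a b = 0" using eq'[OF ab] by (simp add: algebra_simps)
  then show ?thesis using x by auto
qed

text \<open>The disjunction \<open>nz\<close> serves two ends: \<open>x \<noteq> 0\<close> excludes
  further eigenvalues below \<open>m\<close>, while the sum condition at \<open>x = 0\<close> gives
  the kernel hypothesis of \<open>order_0_char_poly_eq_1\<close>.\<close>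

lemma laplacian_rook_graph_eigenvector_eq_0:
  assumes v: "v \<in> carrier_vec (m * m)"
    and ev: "laplacian_mat (rook_graph m) *\<^sub>v v = x \<cdot>\<^sub>v v"
    and x: "x < m" and nz: "x \<noteq> 0 \<or> (\<Sum>i<m * m. v $ i) = 0"
  shows "v = 0\<^sub>v (m * m)"
proof (rule eq_vecI)
  have eq: "2 * real m * v $ (a * m + b) - (\<Sum>b'<m. v $ (a * m + b')) - (\<Sum>a'<m. v $ (a' * m + b)) =
      x * v $ (a * m + b)" if "a < m" "b < m" for a b
    using laplacian_rook_graph_mult_vec[OF v that] v grid_less[OF that] by (simp add: ev)
  have grid: "v $ (a * m + b) = 0" if "a < m" "b < m" for a b
    using rook_eigenfunction_eq_0[of m "\<lambda>a b. v $ (a * m + b)", OF eq x _ that] nz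
    by (simp add: sum_grid)
  fix i assume "i < dim_vec (0\<^sub>v (m * m) :: real vec)"
  then have i: "i < m * m" by simp
  then have "i div m < m" "i mod m < m"
    by (auto simp: less_mult_imp_div_less intro!: mod_less_divisor Nat.gr0I)
  then show "v $ i = 0\<^sub>v (m * m) $ i"
    using grid[of "i div m" "i mod m"] i by simp
qed (use v in simp)

lemma laplacian_count_rook_graph:
  assumes "0 < m"
  shows "laplacian_count (rook_graph m) {0..<1} = 1"
proof -
  let ?L = "laplacian_mat (rook_graph m)"
  note L = laplacian_rook_graph_carrier[of m]
  have order: "Polynomial.order 0 (char_poly ?L) = 1"
  proof (rule order_0_char_poly_eq_1[OF L])
    fix j assume j: "j < m * m"
    \<comment> \<open>The indicators are turned around so that \<open>j\<close> is the fixed cell;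
      the column sum is then \<open>2 * m - m - m\<close>.\<close>
    have "(\<Sum>i<m * m. ?L $$ (i, j)) = (\<Sum>i<m * m. (if i = j then 2 * real m else 0)
      - of_bool (j div m = i div m) * 1 - of_bool (j mod m = i mod m) * 1)"
      using j by (intro sum.cong) (auto simp: laplacian_rook_graph_index)
    also have "\<dots> = 0"
      unfolding sum_subtractf sum_same_row[OF j] sum_same_column[OF j] using j by simp
    finally show "(\<Sum>i<m * m. ?L $$ (i, j)) = 0" .
  next
    fix v assume v: "v \<in> carrier_vec (m * m)" "?L *\<^sub>v v = 0\<^sub>v (m * m)" "(\<Sum>i<m * m. v $ i) = 0"
    have "?L *\<^sub>v v = 0 \<cdot>\<^sub>v v" using v by auto
    then show "v = 0\<^sub>v (m * m)"
      using v assms by (intro laplacian_rook_graph_eigenvector_eq_0) auto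
  qed (use assms in simp)
  \<comment> \<open>That 0 is an eigenvalue is read off from its positive order, without exhibiting
    an eigenvector.\<close>
  have "poly (char_poly ?L) 0 = 0"
    using order order_root by (metis zero_neq_one)
  then have "eigenvalue ?L 0" by (simp add: eigenvalue_root_char_poly[OF L])
  moreover have "x = 0" if x: "x \<in> {0..<1}" and "eigenvalue ?L x" for x
  proof (rule ccontr)
    assume "x \<noteq> 0"
    obtain v where v: "v \<in> carrier_vec (m * m)" "v \<noteq> 0\<^sub>v (m * m)" "?L *\<^sub>v v = x \<cdot>\<^sub>v v"
      using \<open>eigenvalue ?L x\<close> L unfolding eigenvalue_def eigenvector_def by auto
    have "x < m" using x assms by auto
    then show False
      using laplacian_rook_graph_eigenvector_eq_0[OF v(1,3)] \<open>x \<noteq> 0\<close> v(2) by auto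
  qed
  ultimately have "{x \<in> {0..<1}. eigenvalue ?L x} = {0}" by auto
  then show ?thesis by (simp add: laplacian_count_def order)
qed

section \<open>The domination number\<close>

lemma domination_number_rook_graph_ge: "m \<le> domination_number (rook_graph m)"
proof -
  have "m \<le> card S" if S: "dominating_set (rook_graph m) S" for S
  proof (rule ccontr)
    assume small: "\<not> m \<le> card S"
    have sub: "S \<subseteq> {..<m * m}" using S by (simp add: dominating_set_def)
    then have fin: "finite S" by (rule finite_subset) simp
    \<comment> \<open>Fewer than \<open>m\<close> vertices cannot take all \<open>m\<close> values
      of \<open>f\<close>; this is applied to the row and to the column coordinate.\<close>
    have missed: "\<exists>a<m. a \<notin> f ` S" for f :: "nat \<Rightarrow> nat"
    proof (rule ccontr)
      assume "\<not> ?thesis"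
      then have "card {..<m} \<le> card (f ` S)" using fin by (intro card_mono) auto
      then show False using small card_image_le[OF fin, of f] by simp
    qed
    from missed obtain a where a: "a < m" "a \<notin> (\<lambda>u. u div m) ` S" by blast
    from missed obtain b where b: "b < m" "b \<notin> (\<lambda>u. u mod m) ` S" by blast
    define v where "v = a * m + b"
    have v: "v < m * m" "v div m = a" "v mod m = b"
      using a b by (auto simp: v_def grid_less)
    have "v \<notin> S" using a(2) v(2) by blast
    then obtain u where "u \<in> S" "(v, u) \<in> parcs (rook_graph m)"
      using S v(1) by (auto simp: dominating_set_def)
    then show False using a(2) b(2) v by auto
  qed
  \<comment> \<open>A lower bound on \<open>Min\<close> has meaning only for a nonempty finite set;
    the full vertex set is the member that shows nonemptiness.\<close>
  moreover have "dominating_set (rook_graph m) {..<m * m}"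
    by (simp add: dominating_set_def)
  moreover have "finite {S. dominating_set (rook_graph m) S}"
    by (rule finite_subset[of _ "Pow {..<m * m}"]) (auto simp: dominating_set_def)
  ultimately show ?thesis
    unfolding domination_number_def by (subst Min_ge_iff) auto
qed

section \<open>Comparison with the logarithm of the order\<close>

theorem theorem9:
  shows "\<exists>G :: nat \<Rightarrow> nat pair_pre_digraph.
    (\<forall>k\<ge>1. pair_graph (G k) \<and> pverts (G k) \<noteq> {}) \<and>
    filterlim (\<lambda>k. card (pverts (G k))) at_top sequentially \<and>
    (\<lambda>k. real (domination_number (G k)) / real (laplacian_count (G k) {0..<1}))
      \<notin> O(\<lambda>k. ln (real (card (pverts (G k))))) \<and>
    \<not> (\<exists>C :: real. \<forall>k\<ge>1.
      real (domination_number (G k)) / real (laplacian_count (G k) {0..<1})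
        \<le> C * ln (real (card (pverts (G k)))))"
proof (intro exI[of _ rook_graph] conjI)
  let ?r = "\<lambda>k. real (domination_number (rook_graph k)) / real (laplacian_count (rook_graph k) {0..<1})"
  have r: "real k \<le> ?r k" if "k \<ge> 1" for k
    using that domination_number_rook_graph_ge[of k] by (simp add: laplacian_count_rook_graph)
  show not_O: "?r \<notin> O(\<lambda>k. ln (real (card (pverts (rook_graph k)))))"
  proof
    \<comment> \<open>Since \<open>ln (k * k)\<close> is o(k), the assumption makes the quotient
      o(k). But \<open>r\<close> bounds k by the quotient, so k would be o(k), which is absurd for a
      sequence that is not eventually 0.\<close>
    assume "?r \<in> O(\<lambda>k. ln (real (card (pverts (rook_graph k)))))"
    also have "(\<lambda>k. ln (real (card (pverts (rook_graph k))))) \<in> o(\<lambda>k. real k)"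
      unfolding pverts_rook_graph card_lessThan of_nat_mult by real_asymp
    finally have "?r \<in> o(\<lambda>k. real k)" .
    moreover have "(\<lambda>k. real k) \<in> O(?r)"
      by (rule bigoI[of _ 1], rule eventually_sequentiallyI[of 1]) (use r in force)
    ultimately have "(\<lambda>k. real k) \<in> o(\<lambda>k. real k)"
      by (rule landau_o.big_small_trans[rotated])
    then show False
      by (simp add: landau_o.small_refl_iff eventually_sequentially) (metis nat_le_linear not_one_le_zero)
  qed
  show "\<not> (\<exists>C :: real. \<forall>k\<ge>1. ?r k \<le> C * ln (real (card (pverts (rook_graph k)))))"
  proof
    assume "\<exists>C :: real. \<forall>k\<ge>1. ?r k \<le> C * ln (real (card (pverts (rook_graph k))))"
    then obtain C :: real where C: "\<forall>k\<ge>1. ?r k \<le> C * ln (real (card (pverts (rook_graph k))))"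
      by blast
    \<comment> \<open>A constant valid for all \<open>k \<ge> 1\<close> is a special case of the
      big-O relation. The sign of \<open>C\<close> is unknown, hence the absolute value.\<close>
    have "?r \<in> O(\<lambda>k. ln (real (card (pverts (rook_graph k)))))"
    proof (rule bigoI[of _ "\<bar>C\<bar>"], rule eventually_sequentiallyI[of 1])
      fix k :: nat assume "1 \<le> k"
      have "?r k \<le> \<bar>C * ln (real (card (pverts (rook_graph k))))\<bar>"
        using C \<open>1 \<le> k\<close> by (meson abs_ge_self order_trans)
      then show "norm (?r k) \<le> \<bar>C\<bar> * norm (ln (real (card (pverts (rook_graph k)))))"
        by (simp add: abs_mult)
    qed
    with not_O show False ..
  qed
  show "filterlim (\<lambda>k. card (pverts (rook_graph k))) at_top sequentially"
    by (rule filterlim_at_top_mono[OF filterlim_ident]) (auto intro: always_eventually)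
qed (auto simp: pair_graph_rook_graph lessThan_empty_iff)

end
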